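(* Let $\theta>0$, let $\{P_{s,t}\}$ be a stochastically continuous $\theta$-periodic Markovian semigroup on $\mathbb R^m$, and let $\{\mu_s\}_{s\ge0}$ be a family of $\theta$-periodic (probability) measures with respect to $\{P_{s,t}\}$. If $\{P_{s,t}\}$ is regular at $(s,s+\theta)$ for any $s\in[0,\theta)$, then $\{\mu_s\}$ is the unique family of $\theta$-periodic measures with respect to $\{P_{s,t}\}$.
   Context: A (time-inhomogeneous) Markovian semigroup $\{P_{s,t}\}_{0\le s<t}$ on $\mathbb R^m$ is given by Markov transition probability functions $P(s,x,t,A)$ ($x\in\mathbb R^m$, $A\in\mathcal B(\mathbb R^m)$) satisfying the Chapman–Kolmogorov equations, via $P_{s,t}f(x)=\int_{\mathbb R^m}f(y)P(s,x,t,dy)$ for bounded Borel $f$. It is stochastically continuous if $\lim_{t\downarrow s}P(s,x,t,\{y:|y-x|<\delta\})=1$ for all $s\ge0$, $x\in\mathbb R^m$, $\delta>0$. It is $\theta$-periodic if $P(s,x,t,A)=P(s+\theta,x,t+\theta,A)$ for all $0\le s<t$, $x\in\mathbb R^m$, $A\in\mathcal B(\mathbb R^m)$. A family of probability measures $\{\mu_s,s\ge0\}$ on $\mathbb R^m$ is $\theta$-periodic with respect to $\{P_{s,t}\}$ if $\mu_s(A)=\int_{\mathbb R^m}P(s,x,s+\theta,A)\,\mu_s(dx)$ for all $A\in\mathcal B(\mathbb R^m)$ and $s\ge0$. $\{P_{s,t}\}$ is regular at $(s_0,t_0)$ if all the measures $P(s_0,x,t_0,\cdot)$, $x\in\mathbb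 R^m$, are mutually equivalent (mutually absolutely continuous). *)

theory Defs
  imports "HOL-Probability.Probability"
begin

text \<open>
  \<open>P s x t\<close> is the measure \<open>P(s, x, t, \<cdot>)\<close>; it carries meaning only for \<open>0 \<le> s < t\<close>.
  Membership in \<open>borel \<rightarrow>\<^sub>M prob_algebra borel\<close> says that each \<open>P s x t\<close> is a Borel probability measure
  and that \<open>x \<mapsto> P(s, x, t, A)\<close> is Borel measurable for every Borel set \<open>A\<close>. The operators
  \<open>P\<^sub>s\<^sub>,\<^sub>t f(x) = \<integral> f(y) P(s, x, t, dy)\<close> are determined by these kernels, so the
  semigroup is represented by its kernels.
\<close>

type_synonym 'm transition = "real \<Rightarrow> real ^ 'm \<Rightarrow> real \<Rightarrow> (real ^ 'm) measure"

definition markovian_semigroup :: "('m::finite) transition \<Rightarrow> bool" where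
  "markovian_semigroup P \<longleftrightarrow>
     (\<forall>s t. 0 \<le> s \<and> s < t \<longrightarrow> (\<lambda>x. P s x t) \<in> borel \<rightarrow>\<^sub>M prob_algebra borel) \<and>
     (\<forall>s r t x. \<forall>A\<in>sets borel. 0 \<le> s \<and> s < r \<and> r < t \<longrightarrow>
        emeasure (P s x t) A = (\<integral>\<^sup>+ y. emeasure (P r y t) A \<partial>P s x r))"

definition stochastically_continuous :: "('m::finite) transition \<Rightarrow> bool" where
  "stochastically_continuous P \<longleftrightarrow>
     (\<forall>s x \<delta>. 0 \<le> s \<and> 0 < \<delta> \<longrightarrow>
        ((\<lambda>t. measure (P s x t) {y. norm (y - x) < \<delta>}) \<longlongrightarrow> 1) (at_right s))"

definition periodic_semigroup :: "real \<Rightarrow> ('m::finite) transition \<Rightarrow> bool" where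
  "periodic_semigroup \<theta> P \<longleftrightarrow>
     (\<forall>s t x. \<forall>A\<in>sets borel. 0 \<le> s \<and> s < t \<longrightarrow>
        emeasure (P s x t) A = emeasure (P (s + \<theta>) x (t + \<theta>)) A)"

definition periodic_measures ::
    "real \<Rightarrow> ('m::finite) transition \<Rightarrow> (real \<Rightarrow> (real ^ 'm) measure) \<Rightarrow> bool" where
  "periodic_measures \<theta> P \<mu> \<longleftrightarrow>
     (\<forall>s\<ge>0. prob_space (\<mu> s) \<and> sets (\<mu> s) = sets borel \<and>
        (\<forall>A\<in>sets borel. emeasure (\<mu> s) A = (\<integral>\<^sup>+ x. emeasure (P s x (s + \<theta>)) A \<partial>\<mu> s)))"

definition regular_at :: "('m::finite) transition \<Rightarrow> real \<Rightarrow> real \<Rightarrow> bool" where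
  "regular_at P s t \<longleftrightarrow>
     (\<forall>x y. absolutely_continuous (P s x t) (P s y t) \<and>
            absolutely_continuous (P s y t) (P s x t))"

end

theory Submission
  imports Defs
begin

text \<open>
  Each \<open>\<mu> s\<close> is invariant under the single kernel \<open>K x = P s x (s + \<theta>)\<close>, so it suffices that a kernel
  whose measures are mutually absolutely continuous has at most one invariant probability measure.
  Given two of them, \<open>M\<close> and \<open>N\<close>, take a Hahn set \<open>D\<close> for \<open>M - N\<close>. Invariance forces
  \<open>\<integral>\<^sub>D (1 - K x D) dM = \<integral>\<^sub>D (1 - K x D) dN\<close>. By mutual absolute continuity, \<open>K x D\<close> is either \<open>1\<close> for
  all \<open>x\<close> or less than \<open>1\<close> for all \<open>x\<close>; in both cases \<open>M D = N D\<close>, hence \<open>M = N\<close>.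
\<close>

text \<open>A deficit of \<open>N\<close> on \<open>X\<close> would have to be made up on the
  complement of \<open>X\<close>, where \<open>N\<close> is again at most \<open>M\<close>.
  Finiteness lets the complement's mass be cancelled.\<close>

lemma measure_eqI_le_finite:
  assumes "N \<le> M" and sets: "sets N = sets M" and "finite_measure M"
    and space: "emeasure M (space M) = emeasure N (space M)"
  shows "N = M"
proof (rule measure_eqI[OF sets])
  interpret M: finite_measure M by fact
  fix X assume "X \<in> sets N"
  then have X: "X \<in> sets M" by (simp add: sets)
  have le: "emeasure N A \<le> emeasure M A" for A
    using assms by (intro le_measureD3) auto
  have "emeasure M X + emeasure M (space M - X) = emeasure N X + emeasure N (space M - X)"
    using X space by (simp add: plus_emeasure sets Un_absorb1 sets.sets_into_space)
  also have "\<dots> \<le> emeasure N X + emeasure M (space M - X)"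
    by (intro add_left_mono le)
  finally have "emeasure M X \<le> emeasure N X"
    by (simp add: M.emeasure_finite)
  with le show "emeasure N X = emeasure M X" by (intro antisym) auto
qed

text \<open>Weighting by \<open>h\<close> turns the equal integrals into equal finite total masses,
  so the weighted measures coincide by the preceding lemma. Dividing by \<open>h\<close> then
  recovers the measures themselves.\<close>

lemma measure_eqI_le_nn_integral:
  assumes "N \<le> M" and sets: "sets N = sets M"
    and h [measurable]: "h \<in> borel_measurable M"
    and pos: "\<And>x. x \<in> space M \<Longrightarrow> 0 < h x" and fin: "\<And>x. x \<in> space M \<Longrightarrow> h x < \<top>"
    and eq: "(\<integral>\<^sup>+ x. h x \<partial>M) = (\<integral>\<^sup>+ x. h x \<partial>N)" and int: "(\<integral>\<^sup>+ x. h x \<partial>M) < \<top>"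
  shows "N = M"
proof -
  have hN [measurable]: "h \<in> borel_measurable N" using h by (simp cong: measurable_cong_sets add: sets)
  have spaces: "space N = space M" by (rule sets_eq_imp_space_eq[OF sets])
  have "density N h = density M h"
  proof (rule measure_eqI_le_finite)
    show "density N h \<le> density M h"
      using assms by (auto simp: le_measure emeasure_density intro!: nn_integral_mono_measure)
    have "emeasure (density M h) (space M) = (\<integral>\<^sup>+ x. h x \<partial>M)"
      by (simp add: emeasure_density cong: nn_integral_cong)
    moreover have "emeasure (density N h) (space M) = (\<integral>\<^sup>+ x. h x \<partial>N)"
      by (simp add: emeasure_density flip: spaces cong: nn_integral_cong)
    ultimately show "emeasure (density M h) (space (density M h)) = emeasure (density N h) (space (density M h))"
      and "finite_measure (density M h)"
      using eq int by (auto intro!: finite_measureI)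
  qed (simp add: sets)
  then have eq': "density (density N h) (\<lambda>x. 1 / h x) = density (density M h) (\<lambda>x. 1 / h x)"
    by simp
  \<comment> \<open>In \<open>ennreal\<close> this product is 0 when \<open>h x\<close> is 0 or
    \<top>; both strict bounds on \<open>h\<close> enter here.\<close>
  have one: "h x * (1 / h x) = 1" if "x \<in> space M" for x
    using pos[OF that] fin[OF that] by (simp add: ennreal_times_divide ennreal_divide_self)
  have "density (density M h) (\<lambda>x. 1 / h x) = density M (\<lambda>x. 1)"
    using one by (subst density_density_eq) (auto intro!: density_cong)
  moreover have "density (density N h) (\<lambda>x. 1 / h x) = density N (\<lambda>x. 1)"
    using one by (subst density_density_eq) (auto intro!: density_cong simp: spaces)
  ultimately show ?thesis
    using eq' by (simp add: density_1)
qed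

lemma invariant_prob_unique:
  fixes K :: "'a \<Rightarrow> 'a measure"
  assumes K: "K \<in> S \<rightarrow>\<^sub>M prob_algebra S"
    and ac: "\<And>x y. x \<in> space S \<Longrightarrow> y \<in> space S \<Longrightarrow> absolutely_continuous (K x) (K y)"
    and M: "prob_space M" "sets M = sets S"
      "\<And>A. A \<in> sets S \<Longrightarrow> emeasure M A = (\<integral>\<^sup>+ x. emeasure (K x) A \<partial>M)"
    and N: "prob_space N" "sets N = sets S"
      "\<And>A. A \<in> sets S \<Longrightarrow> emeasure N A = (\<integral>\<^sup>+ x. emeasure (K x) A \<partial>N)"
  shows "M = N"
proof -
  interpret M: prob_space M by (rule M)
  interpret N: prob_space N by (rule N)
  have spaces: "space M = space S" "space N = space S"
    using M(2) N(2) by (auto dest: sets_eq_imp_space_eq)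
  have Kx: "prob_space (K x)" "sets (K x) = sets S" "space (K x) = space S" if "x \<in> space S" for x
    using measurable_space[OF K that] by (auto simp: space_prob_algebra dest: sets_eq_imp_space_eq)
  obtain D where D: "D \<in> sets M"
    and D1: "\<And>X. X \<in> sets M \<Longrightarrow> X \<subseteq> D \<Longrightarrow> emeasure N X \<le> emeasure M X"
    and D2: "\<And>X. X \<in> sets M \<Longrightarrow> X \<inter> D = {} \<Longrightarrow> emeasure M X \<le> emeasure N X"
    using finite_unsigned_Hahn_decomposition[of M N] M.finite_measure_axioms N.finite_measure_axioms
      M(2) N(2) by auto
  have DS [measurable]: "D \<in> sets S" "D \<in> sets M" "D \<in> sets N" using D M(2) N(2) by auto
  define k where "k x = emeasure (K x) D" for x
  have kS: "k \<in> borel_measurable S"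
    unfolding k_def using measurable_prob_algebraD[OF K] DS(1) by measurable
  then have k [measurable]: "k \<in> borel_measurable M" "k \<in> borel_measurable N"
    using M(2) N(2) by (simp_all cong: measurable_cong_sets)
  have k_le: "k x \<le> 1" if "x \<in> space S" for x
    unfolding k_def using prob_space.emeasure_le_1[OF Kx(1)[OF that]] .
  let ?D = "indicator D :: 'a \<Rightarrow> ennreal" and ?C = "indicator (space S - D) :: 'a \<Rightarrow> ennreal"
  \<comment> \<open>The Hahn decomposition as order of measures: \<open>N\<close> lies below
    \<open>M\<close> on \<open>D\<close>, and \<open>M\<close> below \<open>N\<close> off
    \<open>D\<close>.\<close>
  have ND: "density N ?D \<le> density M ?D"
    using D1 M(2) N(2) by (auto simp: le_measure emeasure_restricted)
  have MC: "density M ?C \<le> density N ?C"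
    using M(2) N(2) by (auto simp: le_measure emeasure_restricted intro!: D2)
  \<comment> \<open>Two accounts of the mass of \<open>D\<close>: after one step it came from
    \<open>D\<close> or from the complement; before the step it stays in \<open>D\<close> or leaves.
    Comparing them, the outflow from \<open>D\<close> equals the inflow into
    \<open>D\<close>.\<close>
  have split: "emeasure L D = (\<integral>\<^sup>+x. k x \<partial>density L ?D) + (\<integral>\<^sup>+x. k x \<partial>density L ?C)"
    "emeasure L D = (\<integral>\<^sup>+x. k x \<partial>density L ?D) + (\<integral>\<^sup>+x. 1 - k x \<partial>density L ?D)"
    if L: "sets L = sets S" "emeasure L D = (\<integral>\<^sup>+x. k x \<partial>L)" for L
  proof -
    have [measurable]: "k \<in> borel_measurable L" "D \<in> sets L" "space S - D \<in> sets L"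
      using kS L(1) by (simp_all cong: measurable_cong_sets)
    have sp: "space L = space S" using L(1) by (rule sets_eq_imp_space_eq)
    have "emeasure L D = (\<integral>\<^sup>+x. ?D x * k x + ?C x * k x \<partial>L)"
      unfolding L(2) by (intro nn_integral_cong) (auto simp: sp split: split_indicator)
    then show "emeasure L D = (\<integral>\<^sup>+x. k x \<partial>density L ?D) + (\<integral>\<^sup>+x. k x \<partial>density L ?C)"
      by (simp add: nn_integral_density nn_integral_add)
    have "emeasure L D = (\<integral>\<^sup>+x. ?D x \<partial>L)" by simp
    also have "\<dots> = (\<integral>\<^sup>+x. ?D x * k x + ?D x * (1 - k x) \<partial>L)"
      by (intro nn_integral_cong) (auto simp: sp add_diff_inverse_ennreal k_le split: split_indicator)
    finally show "emeasure L D = (\<integral>\<^sup>+x. k x \<partial>density L ?D) + (\<integral>\<^sup>+x. 1 - k x \<partial>density L ?D)"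
      by (simp add: nn_integral_density nn_integral_add)
  qed
  note splitM = split[OF M(2) M(3)[OF DS(1), folded k_def]]
    and splitN = split[OF N(2) N(3)[OF DS(1), folded k_def]]
  have cancel: "b = c" if "emeasure L D = a + b" "emeasure L D = a + c" "finite_measure L"
    for a b c L
    using that finite_measure.emeasure_finite[of L D]
    by (metis ennreal_add_left_cancel ennreal_add_eq_top)
  \<comment> \<open>Outflow under \<open>M\<close> is inflow under \<open>M\<close>, at most inflow
    under \<open>N\<close>, which is outflow under \<open>N\<close>. Since \<open>N\<close> is below
    \<open>M\<close> on \<open>D\<close>, the outflows also compare the other way.\<close>
  have "(\<integral>\<^sup>+x. 1 - k x \<partial>density M ?D) = (\<integral>\<^sup>+x. k x \<partial>density M ?C)"
    using cancel[OF splitM(2,1)] M.finite_measure_axioms .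
  also have "\<dots> \<le> (\<integral>\<^sup>+x. k x \<partial>density N ?C)"
    using MC M(2) N(2) by (intro nn_integral_mono_measure) auto
  also have "\<dots> = (\<integral>\<^sup>+x. 1 - k x \<partial>density N ?D)"
    using cancel[OF splitN(1,2)] N.finite_measure_axioms .
  finally have "(\<integral>\<^sup>+x. 1 - k x \<partial>density M ?D) \<le> (\<integral>\<^sup>+x. 1 - k x \<partial>density N ?D)" .
  moreover have "(\<integral>\<^sup>+x. 1 - k x \<partial>density N ?D) \<le> (\<integral>\<^sup>+x. 1 - k x \<partial>density M ?D)"
    using ND M(2) N(2) by (intro nn_integral_mono_measure) auto
  ultimately have eq: "(\<integral>\<^sup>+x. 1 - k x \<partial>density M ?D) = (\<integral>\<^sup>+x. 1 - k x \<partial>density N ?D)"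
    by (rule antisym)
  have "emeasure M D = emeasure N D"
  proof (cases "\<exists>x\<in>space S. k x = 1")
    case True
    then obtain x where x: "x \<in> space S" "k x = 1" by auto
    have k1: "k y = 1" if y: "y \<in> space S" for y
    proof -
      \<comment> \<open>The complement of \<open>D\<close> is null for \<open>K x\<close>, hence
        null for every \<open>K y\<close>.\<close>
      have "AE z in K x. z \<in> D"
        using x Kx[OF x(1)] by (intro prob_space.AE_prob_1) (auto simp: k_def measure_def)
      then have "AE z in K y. z \<in> D"
        using ac[OF x(1) y] Kx[OF x(1)] Kx[OF y]
        by (intro absolutely_continuous_AE[where M = "K x" and M' = "K y"]) auto
      then show ?thesis
        unfolding k_def using Kx[OF y] by (intro prob_space.emeasure_eq_1_AE) auto
    qed
    have "emeasure M D = (\<integral>\<^sup>+x. 1 \<partial>M)"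
      unfolding M(3)[OF DS(1), folded k_def] by (intro nn_integral_cong) (simp add: k1 spaces)
    moreover have "emeasure N D = (\<integral>\<^sup>+x. 1 \<partial>N)"
      unfolding N(3)[OF DS(1), folded k_def] by (intro nn_integral_cong) (simp add: k1 spaces)
    ultimately show ?thesis by (simp add: M.emeasure_space_1 N.emeasure_space_1)
  next
    case False
    \<comment> \<open>Here the escape probability \<open>1 - k x\<close> is positive everywhere, so
      it can serve as the weight \<open>h\<close>.\<close>
    have "density N ?D = density M ?D"
    proof (rule measure_eqI_le_nn_integral[OF ND _ _ _ _ eq])
      show "0 < 1 - k x" if "x \<in> space (density M ?D)" for x
        using that False k_le[of x] by (intro diff_gr0_ennreal) (auto simp: spaces order_less_le)
      show "1 - k x < \<top>" for x
        by (rule le_less_trans[OF diff_le_self_ennreal]) simp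
      have "(\<integral>\<^sup>+x. 1 - k x \<partial>density M ?D) \<le> emeasure M D"
        unfolding splitM(2) by simp
      then show "(\<integral>\<^sup>+x. 1 - k x \<partial>density M ?D) < \<top>"
        by (rule le_less_trans) (simp flip: less_top)
    qed (use M(2) N(2) in auto)
    then have "emeasure (density N ?D) D = emeasure (density M ?D) D" by simp
    then show ?thesis by (simp add: emeasure_restricted)
  qed
  \<comment> \<open>Equal mass on \<open>D\<close> together with the order on \<open>D\<close> gives
    equality of the restrictions, now in both cases.\<close>
  then have "density N ?D = density M ?D"
    using ND M(2) N(2) spaces
    by (intro measure_eqI_le_finite)
       (auto simp: emeasure_restricted sets.Int_space_eq2 intro!: finite_measureI)
  then have eqD: "emeasure N (D \<inter> X) = emeasure M (D \<inter> X)" if "X \<in> sets S" for X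
    using that M(2) N(2) by (metis DS(2,3) emeasure_restricted)
  \<comment> \<open>Equality on \<open>D\<close> and the order off \<open>D\<close> yield
    \<open>M \<le> N\<close> globally; equal total mass 1 then finishes.\<close>
  have "emeasure M X \<le> emeasure N X" if X: "X \<in> sets S" for X
  proof -
    have "emeasure M X = emeasure M (D \<inter> X) + emeasure M (X - D)"
      using X M(2) by (subst plus_emeasure) (auto intro!: arg_cong[where f = "emeasure M"])
    also have "\<dots> \<le> emeasure N (D \<inter> X) + emeasure N (X - D)"
      using X M(2) by (intro add_mono[OF eq_refl D2]) (auto simp: eqD)
    also have "\<dots> = emeasure N X"
      using X N(2) by (subst plus_emeasure) (auto intro!: arg_cong[where f = "emeasure N"])
    finally show ?thesis .
  qed
  then have "M \<le> N" using M(2) N(2) by (simp add: le_measure)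
  then show "M = N"
    using M(2) N(2) M.emeasure_space_1 N.emeasure_space_1 N.finite_measure_axioms spaces
    by (intro measure_eqI_le_finite) auto
qed

text \<open>Iterates the one-period identity, upgraded from equality on Borel sets to equality of
  measures. It carries regularity from starting times in one period to all later ones.\<close>

lemma periodic_semigroup_shift:
  assumes \<theta>: "0 < \<theta>" and P: "markovian_semigroup P" "periodic_semigroup \<theta> P"
    and st: "0 \<le> s" "s < t"
  shows "P (s + real n * \<theta>) x (t + real n * \<theta>) = P s x t"
proof (induction n)
  case (Suc n)
  have sets: "sets (P u x v) = sets borel" if "0 \<le> u" "u < v" for u v
    using that P(1) measurable_space[of "\<lambda>x. P u x v" borel "prob_algebra borel" x]
    by (auto simp: markovian_semigroup_def space_prob_algebra)
  let ?u = "s + real n * \<theta>" and ?v = "t + real n * \<theta>"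
  have u: "0 \<le> ?u" "?u < ?v" using st \<theta> by auto
  have "P ?u x ?v = P (?u + \<theta>) x (?v + \<theta>)"
  proof (rule measure_eqI)
    show "sets (P ?u x ?v) = sets (P (?u + \<theta>) x (?v + \<theta>))"
      using u \<theta> sets[of ?u ?v] sets[of "?u + \<theta>" "?v + \<theta>"] by simp
    show "emeasure (P ?u x ?v) A = emeasure (P (?u + \<theta>) x (?v + \<theta>)) A" if "A \<in> sets (P ?u x ?v)" for A
      using that u P(2) sets[OF u] unfolding periodic_semigroup_def by blast
  qed
  with Suc show ?case by (simp add: algebra_simps)
qed simp

theorem lemma3p13:
  fixes \<theta> :: real
    and P :: "('m::finite) transition"
    and \<mu> :: "real \<Rightarrow> (real ^ 'm) measure"
  assumes "0 < \<theta>"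
    and "markovian_semigroup P"
    and "stochastically_continuous P"
    and "periodic_semigroup \<theta> P"
    and "periodic_measures \<theta> P \<mu>"
    and "\<And>s. s \<in> {0..<\<theta>} \<Longrightarrow> regular_at P s (s + \<theta>)"
  shows "\<forall>\<nu>. periodic_measures \<theta> P \<nu> \<longleftrightarrow> (\<forall>s\<ge>0. \<nu> s = \<mu> s)"
proof (intro allI iffI impI)
  fix \<nu> and s :: real assume \<nu>: "periodic_measures \<theta> P \<nu>" and s: "0 \<le> s"
  \<comment> \<open>Write \<open>s\<close> as \<open>n\<close> full periods plus a remainder
    \<open>r\<close> in \<open>{0..<\<theta>}\<close>, where regularity is assumed.\<close>
  define n where "n = nat \<lfloor>s / \<theta>\<rfloor>"
  define r where "r = s - real n * \<theta>"
  have "real n = \<lfloor>s / \<theta>\<rfloor>" using s \<open>0 < \<theta>\<close> by (simp add: n_def)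
  then have "real n \<le> s / \<theta>" "s / \<theta> < real n + 1" by linarith+
  then have r: "r \<in> {0..<\<theta>}" using \<open>0 < \<theta>\<close> by (auto simp: r_def field_simps)
  have "P s x (s + \<theta>) = P r x (r + \<theta>)" for x
    using periodic_semigroup_shift[OF assms(1,2,4), of r "r + \<theta>" n x] r \<open>0 < \<theta>\<close>
    by (simp add: r_def)
  with assms(6)[OF r] have ac: "absolutely_continuous (P s x (s + \<theta>)) (P s y (s + \<theta>))" for x y
    by (simp add: regular_at_def)
  have "(\<lambda>x. P s x (s + \<theta>)) \<in> borel \<rightarrow>\<^sub>M prob_algebra borel"
    using assms(1,2) s by (simp add: markovian_semigroup_def)
  then show "\<nu> s = \<mu> s"
    using ac \<nu> assms(5) s
    by (intro invariant_prob_unique[where S = borel and K = "\<lambda>x. P s x (s + \<theta>)"])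
       (auto simp: periodic_measures_def)
next
  fix \<nu> assume "\<forall>s\<ge>0. \<nu> s = \<mu> s"
  with assms(5) show "periodic_measures \<theta> P \<nu>" by (simp add: periodic_measures_def)
qed

end
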